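(* Assume NCF holds. Let $U\subseteq[\omega]^\omega$ be an ultrafilter. Then every $\mathfrak d$-unbounded set in $[\omega]^\omega$ is a $U$-scale.
   Context: Elements of $[\omega]^\omega$ are identified with increasing enumerations; $\mathfrak d$ is the least size of a $\le^*$-dominating subset of $[\omega]^\omega$. For $a,b\in[\omega]^\omega$, $a\le b$ means $a(n)\le b(n)$ for all $n$. $X\subseteq[\omega]^\omega$ is $\mathfrak d$-unbounded if $|X|\ge\mathfrak d$ and $|\{a\in X:a\le c\}|<\mathfrak d$ for each $c\in[\omega]^\omega$. Ultrafilter: nonprincipal ultrafilter on $\omega$. $U$ is near coherent to $\tilde U$ if there is $h\in[\omega]^\omega$ such that for each $u\in U$, $\bigcup\{[h(n),h(n+1)):u\cap[h(n),h(n+1))\ne\emptyset\}\in\tilde U$. NCF (near coherence of filters) is the statement that any two ultrafilters are near coherent. $a\le_U b$ iff $\{n:a(n)\le b(n)\}\in U$; $\mathfrak b(U)$ is the least size of a $\le_U$-unbounded set; $U^+=\{a:\omega\setminus a\notin U\}$. $X$ is a $U$-scale if $|X|\ge\mathfrak b(U)$ and for every $d$ there are $c$ and $S\subseteq X$, $|S|<\mathfrak b(U)$, with $d\le_{U^+}c\le_U x$ for all $x\in X\setminus S$. *)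

theory Defs
  imports Main "HOL-Library.Infinite_Set"
begin

unbundle cardinal_syntax

text \<open>A member \<open>a\<close> of \<open>[\<omega>]\<^sup>\<omega>\<close> is a set; its value \<open>a(n)\<close> under the identification with its increasing
  enumeration is \<^term>\<open>enumerate a n\<close>.\<close>

definition inf_sets :: "nat set set" where
  "inf_sets = {a. infinite a}"

definition le_everywhere :: "nat set \<Rightarrow> nat set \<Rightarrow> bool" where
  "le_everywhere a b \<longleftrightarrow> (\<forall>n. enumerate a n \<le> enumerate b n)"

definition le_star :: "nat set \<Rightarrow> nat set \<Rightarrow> bool" where
  "le_star a b \<longleftrightarrow> (\<forall>\<^sub>\<infinity>n. enumerate a n \<le> enumerate b n)"

definition le_mod :: "nat set set \<Rightarrow> nat set \<Rightarrow> nat set \<Rightarrow> bool" where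
  "le_mod F a b \<longleftrightarrow> {n. enumerate a n \<le> enumerate b n} \<in> F"

definition ultrafilter :: "nat set set \<Rightarrow> bool" where
  "ultrafilter U \<longleftrightarrow>
     UNIV \<in> U \<and> {} \<notin> U \<and>
     (\<forall>a\<in>U. \<forall>b. a \<subseteq> b \<longrightarrow> b \<in> U) \<and>
     (\<forall>a\<in>U. \<forall>b\<in>U. a \<inter> b \<in> U) \<and>
     (\<forall>a. a \<in> U \<or> - a \<in> U) \<and>
     (\<forall>n. {n} \<notin> U)"

definition positive_sets :: "nat set set \<Rightarrow> nat set set" where
  "positive_sets U = {a. - a \<notin> U}"

definition near_coherent :: "nat set set \<Rightarrow> nat set set \<Rightarrow> bool" where
  "near_coherent U V \<longleftrightarrow>
     (\<exists>h\<in>inf_sets. \<forall>u\<in>U.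
        \<Union>{{enumerate h n..<enumerate h (Suc n)} | n.
            u \<inter> {enumerate h n..<enumerate h (Suc n)} \<noteq> {}} \<in> V)"

definition NCF :: bool where
  "NCF \<longleftrightarrow> (\<forall>U V. ultrafilter U \<and> ultrafilter V \<longrightarrow> near_coherent U V)"

text \<open>Cardinals are well-order relations compared by \<open>\<le>o\<close> and \<open><o\<close>. The least size of a member of a
  nonempty family is determined only up to \<open>=o\<close>, so a representative is chosen.\<close>

definition least_card :: "'a set set \<Rightarrow> 'a rel" where
  "least_card \<A> = (SOME r. r \<in> card_of ` \<A> \<and> (\<forall>A\<in>\<A>. r \<le>o |A| ))"

lemma least_card_props:
  assumes "\<A> \<noteq> {}"
  shows "least_card \<A> \<in> card_of ` \<A> \<and> (\<forall>A\<in>\<A>. least_card \<A> \<le>o |A| )"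
  unfolding least_card_def
proof (rule someI_ex)
  have "\<exists>r\<in>card_of ` \<A>. \<forall>r'\<in>card_of ` \<A>. r \<le>o r'"
    using assms by (intro exists_minim_Card_order) (auto simp: card_of_Card_order)
  then show "\<exists>r. r \<in> card_of ` \<A> \<and> (\<forall>A\<in>\<A>. r \<le>o |A| )" by blast
qed

definition dominating :: "nat set set \<Rightarrow> bool" where
  "dominating D \<longleftrightarrow> D \<subseteq> inf_sets \<and> (\<forall>a\<in>inf_sets. \<exists>b\<in>D. le_star a b)"

definition dominating_number :: "nat set rel" where
  "dominating_number = least_card {D. dominating D}"

definition unbounded_mod :: "nat set set \<Rightarrow> nat set set \<Rightarrow> bool" where
  "unbounded_mod U Y \<longleftrightarrow> Y \<subseteq> inf_sets \<and> \<not> (\<exists>c\<in>inf_sets. \<forall>a\<in>Y. le_mod U a c)"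

definition bounding_number_mod :: "nat set set \<Rightarrow> nat set rel" where
  "bounding_number_mod U = least_card {Y. unbounded_mod U Y}"

lemma dominating_inf_sets: "dominating inf_sets"
  unfolding dominating_def le_star_def by (auto intro!: bexI)

lemma unbounded_mod_inf_sets:
  assumes "ultrafilter U"
  shows "unbounded_mod U inf_sets"
proof -
  have "\<exists>a\<in>inf_sets. \<not> le_mod U a c" if "c \<in> inf_sets" for c
  proof
    have inf: "infinite c" using that by (simp add: inf_sets_def)
    let ?a = "c - {enumerate c 0}"
    show "?a \<in> inf_sets" using inf by (simp add: inf_sets_def)
    have "enumerate c n < enumerate ?a n" for n
      using enumerate_step[OF inf, of n] by (simp add: enumerate_Suc' del: enumerate_0)
    then have "{n. enumerate ?a n \<le> enumerate c n} = {}" by (auto simp: not_le)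
    then show "\<not> le_mod U ?a c"
      using assms by (simp add: le_mod_def ultrafilter_def)
  qed
  then show ?thesis by (auto simp: unbounded_mod_def)
qed

definition d_unbounded :: "nat set set \<Rightarrow> bool" where
  "d_unbounded X \<longleftrightarrow> X \<subseteq> inf_sets \<and> dominating_number \<le>o |X| \<and>
     (\<forall>c\<in>inf_sets. |{a \<in> X. le_everywhere a c}| <o dominating_number)"

definition scale_mod :: "nat set set \<Rightarrow> nat set set \<Rightarrow> bool" where
  "scale_mod U X \<longleftrightarrow> X \<subseteq> inf_sets \<and> bounding_number_mod U \<le>o |X| \<and>
     (\<forall>d\<in>inf_sets. \<exists>c\<in>inf_sets. \<exists>S. S \<subseteq> X \<and> |S| <o bounding_number_mod U \<and>
        le_mod (positive_sets U) d c \<and> (\<forall>x\<in>X - S. le_mod U c x))"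

end

theory Submission
  imports Defs "HOL-Library.Countable_Set_Type" "HOL-Algebra.Free_Abelian_Groups"
begin

text \<open>
  For infinite \<open>b\<close> call \<open>m\<close>, \<open>k\<close> \<open>b\<close>-close if \<open>k \<le> b(m)\<close> and \<open>m \<le> b(k)\<close>, and let \<open>N\<^sub>b(A)\<close> be the set of
  points \<open>b\<close>-close to \<open>A\<close>. Fix a dominating family \<open>D\<close> of size \<open>\<dd>\<close>. Under NCF there are \<open>b \<in> D\<close>
  and a family \<open>F\<close> of fewer than \<open>\<dd>\<close> infinite sets such that each \<open>N\<^sub>b(A)\<close>, \<open>A \<in> U\<close>, includes a
  member of \<open>F\<close>: otherwise a recursion of length \<open>\<dd>\<close> picks \<open>A\<^sub>b \<in> U\<close> for \<open>b \<in> D\<close> such that the complements of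
  the \<open>N\<^sub>b(A\<^sub>b)\<close> lie in one ultrafilter, which is then not near coherent to \<open>U\<close>.

  Given \<open>b\<close> and \<open>F\<close>, \<open>x \<le>\<^sub>U d\<close> implies that for some \<open>B \<in> F\<close> we have \<open>x(n) \<le> d(b(B(b(n) + 1)))\<close> for all \<open>n\<close>.
  Hence any family of fewer than \<open>\<dd>\<close> sets is \<open>\<le>\<^sub>U\<close>-bounded, so \<open>\<bb>(U) = \<dd>\<close>, and the part of a \<open>\<dd>\<close>-unbounded set
  lying \<open>\<le>\<^sub>U\<close>-below \<open>d\<close> is a union of fewer than \<open>\<dd>\<close> sets of size less than \<open>\<dd>\<close>. This union
  is small because \<open>\<bb>(U)\<close> is regular.
\<close>

subsection \<open>Ultrafilters\<close>

text \<open>Infinite rather than nonempty intersections are demanded so that maximal families become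
  nonprincipal.\<close>

definition strong_fip :: "'a set set \<Rightarrow> bool" where
  "strong_fip \<F> \<longleftrightarrow> (\<forall>T. finite T \<longrightarrow> T \<subseteq> \<F> \<longrightarrow> infinite (\<Inter>T))"

text \<open>If both extensions failed, drop \<open>a\<close> from one finite witness and
  \<open>- a\<close> from the other. Every point lies in \<open>a\<close> or in \<open>- a\<close>,
  so the intersection of what remains is covered by two finite sets.\<close>

lemma strong_fip_insert_or_Compl:
  assumes "strong_fip \<F>"
  shows "strong_fip (insert a \<F>) \<or> strong_fip (insert (- a) \<F>)"
proof (rule ccontr)
  assume "\<not> ?thesis"
  then obtain S T where S: "finite S" "S \<subseteq> insert a \<F>" "finite (\<Inter>S)"
    and T: "finite T" "T \<subseteq> insert (- a) \<F>" "finite (\<Inter>T)"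
    unfolding strong_fip_def by blast
  let ?R = "(S - {a}) \<union> (T - {- a})"
  have "\<Inter>?R \<subseteq> \<Inter>S \<union> \<Inter>T" by blast
  then have "finite (\<Inter>?R)" using S(3) T(3) by (meson finite_Un finite_subset)
  moreover have "finite ?R" "?R \<subseteq> \<F>" using S T by auto
  ultimately show False using assms by (simp add: strong_fip_def)
qed

lemma ultrafilter_extension:
  fixes \<F> :: "nat set set"
  assumes "strong_fip \<F>"
  obtains V where "ultrafilter V" "\<F> \<subseteq> V"
proof -
  let ?P = "{M. \<F> \<subseteq> M \<and> strong_fip M}"
  \<comment> \<open>Zorn's lemma: a finite subset of the union of a chain already lies in one member
    of the chain.\<close>
  have "\<exists>M\<in>?P. \<forall>X\<in>?P. M \<subseteq> X \<longrightarrow> X = M"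
  proof (rule subset_Zorn_nonempty)
    show "?P \<noteq> {}" using assms by blast
    fix \<C> assume ne: "\<C> \<noteq> {}" and ch: "subset.chain ?P \<C>"
    have "infinite (\<Inter>T)" if T: "finite T" "T \<subseteq> \<Union>\<C>" for T
    proof -
      obtain M where "M \<in> \<C>" "T \<subseteq> M"
        using finite_subset_Union_chain[OF T ne ch] by blast
      then show ?thesis using ch T(1) unfolding subset.chain_def strong_fip_def by blast
    qed
    moreover have "\<F> \<subseteq> \<Union>\<C>" using ne ch unfolding subset.chain_def by blast
    ultimately show "\<Union>\<C> \<in> ?P" by (simp add: strong_fip_def)
  qed
  then obtain M where M: "M \<in> ?P" and max: "\<forall>X\<in>?P. M \<subseteq> X \<longrightarrow> X = M" ..
  then have FM: "\<F> \<subseteq> M" and fip: "strong_fip M" by simp_all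
  have ins: "a \<in> M" if "strong_fip (insert a M)" for a
  proof -
    have "insert a M \<in> ?P" using that FM by (simp add: subset_insertI2)
    then have "insert a M = M" using max by (simp add: subset_insertI)
    then show ?thesis by (metis insertI1)
  qed
  have dich: "a \<in> M \<or> - a \<in> M" for a
    using strong_fip_insert_or_Compl[OF fip, of a] ins[of a] ins[of "- a"] by argo
  have inter: "infinite (\<Inter>T)" if "finite T" "T \<subseteq> M" for T
    using fip that by (simp add: strong_fip_def)
  have fin: "a \<notin> M" if "finite a" for a
    using inter[of "{a}"] that by fastforce
  have up: "b \<in> M" if "a \<in> M" "a \<subseteq> b" for a b
  proof (rule ccontr)
    assume "b \<notin> M"
    then have "- b \<in> M" using dich by blast
    then have "infinite (\<Inter>{a, - b})" using that by (intro inter) auto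
    moreover have "\<Inter>{a, - b} = {}" using that by auto
    ultimately show False by simp
  qed
  have int: "a \<inter> b \<in> M" if "a \<in> M" "b \<in> M" for a b
  proof (rule ccontr)
    assume "a \<inter> b \<notin> M"
    then have "- (a \<inter> b) \<in> M" using dich by blast
    then have "infinite (\<Inter>{a, b, - (a \<inter> b)})" using that by (intro inter) auto
    moreover have "\<Inter>{a, b, - (a \<inter> b)} = {}" by auto
    ultimately show False by simp
  qed
  have "UNIV \<in> M" using dich[of UNIV] fin[of "{}"] by auto
  then have "ultrafilter M"
    unfolding ultrafilter_def using fin up int dich by auto
  then show thesis using that FM by blast
qed

lemma ultrafilter_finite:
  assumes U: "ultrafilter U" and "finite a"
  shows "a \<notin> U"
  using assms(2)
proof induction
  case empty
  then show ?case using U by (simp add: ultrafilter_def)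
next
  case (insert x a)
  have "- a \<in> U" "- {x} \<in> U" using U insert.IH unfolding ultrafilter_def by blast+
  then have "- a \<inter> - {x} \<in> U" using U unfolding ultrafilter_def by blast
  then have "insert x a \<notin> U"
    using U unfolding ultrafilter_def by (metis Compl_Un Compl_disjoint insert_is_Un inf_commute)
  then show ?case .
qed

lemma le_mod_linear:
  assumes "ultrafilter U" "\<not> le_mod U a b"
  shows "le_mod U b a"
proof -
  have "- {n. enumerate a n \<le> enumerate b n} \<in> U"
    using assms unfolding le_mod_def ultrafilter_def by blast
  moreover have "- {n. enumerate a n \<le> enumerate b n} \<subseteq> {n. enumerate b n \<le> enumerate a n}"
    by auto
  ultimately show ?thesis using assms(1) unfolding le_mod_def ultrafilter_def by blast
qed

lemma le_mod_trans:
  assumes U: "ultrafilter U" and "le_mod U a b" "le_mod U b c"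
  shows "le_mod U a c"
proof -
  have "{n. enumerate a n \<le> enumerate b n} \<inter> {n. enumerate b n \<le> enumerate c n} \<in> U"
    using assms unfolding le_mod_def ultrafilter_def by blast
  moreover have "{n. enumerate a n \<le> enumerate b n} \<inter> {n. enumerate b n \<le> enumerate c n}
      \<subseteq> {n. enumerate a n \<le> enumerate c n}" by auto
  ultimately show ?thesis using U unfolding le_mod_def ultrafilter_def by blast
qed

lemma enumerate_range_strict_mono:
  fixes s :: "nat \<Rightarrow> nat"
  assumes s: "strict_mono s"
  shows "enumerate (range s) n = s n"
proof (induction n)
  case 0
  have "(LEAST k. k \<in> range s) = s 0"
    by (rule Least_equality) (auto simp: strict_mono_less_eq[OF s])
  then show ?case by (simp add: enumerate_0)
next
  case (Suc n)
  have inf: "infinite (range s)"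
    using s by (simp add: range_inj_infinite strict_mono_imp_inj_on)
  have "(LEAST k. k \<in> range s \<and> s n < k) = s (Suc n)"
    by (rule Least_equality) (auto simp: strict_mono_less_eq[OF s] strict_mono_less[OF s])
  then show ?case using Suc by (simp add: enumerate_Suc''[OF inf])
qed

lemma range_strict_mono_in_inf_sets: "strict_mono (s :: nat \<Rightarrow> nat) \<Longrightarrow> range s \<in> inf_sets"
  by (simp add: inf_sets_def range_inj_infinite strict_mono_imp_inj_on)

subsection \<open>The cardinals\<close>

lemma dominating_number_attained:
  obtains D where "dominating D" "dominating_number = |D|"
proof -
  have "dominating_number \<in> card_of ` {D. dominating D}"
    unfolding dominating_number_def
    using least_card_props[of "{D. dominating D}"] dominating_inf_sets by blast
  then show thesis using that by blast
qed

lemma dominating_number_le: "dominating D \<Longrightarrow> dominating_number \<le>o |D|"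
  unfolding dominating_number_def
  using least_card_props[of "{D. dominating D}"] by blast

lemma bounding_number_mod_attained:
  assumes "ultrafilter U"
  obtains Y where "unbounded_mod U Y" "bounding_number_mod U = |Y|"
proof -
  have "bounding_number_mod U \<in> card_of ` {Y. unbounded_mod U Y}"
    unfolding bounding_number_mod_def
    using least_card_props[of "{Y. unbounded_mod U Y}"] unbounded_mod_inf_sets[OF assms] by blast
  then show thesis using that by blast
qed

lemma bounding_number_mod_le: "unbounded_mod U Y \<Longrightarrow> bounding_number_mod U \<le>o |Y|"
  unfolding bounding_number_mod_def
  using least_card_props[of "{Y. unbounded_mod U Y}"] by blast


lemma dominating_uncountable:
  assumes D: "dominating D"
  shows "uncountable D"
proof
  assume count: "countable D"
  have "UNIV \<in> inf_sets" by (simp add: inf_sets_def)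
  then have "D \<noteq> {}" using D unfolding dominating_def by blast
  then obtain e :: "nat \<Rightarrow> nat set" where e: "D = range e"
    using count by (metis range_from_nat_into)
  \<comment> \<open>Diagonalisation: the term for \<open>j = n\<close> exceeds the value at
    \<open>n\<close> of each \<open>e i\<close> with \<open>i \<le> n\<close>, and the outer sum
    makes \<open>s\<close> strictly increasing.\<close>
  define s where "s n = (\<Sum>j\<le>n. Suc (\<Sum>i\<le>j. enumerate (e i) j))" for n
  have s: "strict_mono s"
    unfolding strict_mono_Suc_iff s_def by simp
  have gt: "enumerate (e i) n < s n" if "i \<le> n" for i n
  proof -
    have "enumerate (e i) n \<le> (\<Sum>i\<le>n. enumerate (e i) n)"
      using that by (intro member_le_sum) auto
    also have "\<dots> < Suc (\<Sum>i\<le>n. enumerate (e i) n)" by simp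
    also have "\<dots> \<le> s n"
      unfolding s_def by (intro member_le_sum) auto
    finally show ?thesis .
  qed
  obtain i where "le_star (range s) (e i)"
    using D e range_strict_mono_in_inf_sets[OF s] unfolding dominating_def by blast
  then obtain M where "\<forall>n\<ge>M. s n \<le> enumerate (e i) n"
    unfolding le_star_def enumerate_range_strict_mono[OF s] MOST_nat_le by blast
  then have "s (max M i) \<le> enumerate (e i) (max M i)" by simp
  with gt[of i "max M i"] show False by simp
qed

lemma card_of_nat_less_dominating_number: "|UNIV :: nat set| <o dominating_number"
proof -
  obtain D where D: "dominating D" "dominating_number = |D|"
    by (rule dominating_number_attained)
  have "\<not> |D| \<le>o |UNIV :: nat set|"
    using dominating_uncountable[OF D(1)] by (simp add: countable_card_of_nat)
  then show ?thesis
    unfolding D(2) by (simp add: not_ordLeq_iff_ordLess card_of_Well_order)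
qed

text \<open>Regularity of \<open>bounding_number_mod U\<close>: a large union would map onto an
  unbounded \<open>Y\<close>. Each piece of \<open>Y\<close> is bounded by some \<open>c i\<close>,
  the few \<open>c i\<close> have a common bound, and transitivity of \<open>le_mod U\<close> bounds
  all of \<open>Y\<close>.\<close>

lemma card_of_UN_less_bounding_number_mod:
  assumes U: "ultrafilter U"
    and I: "|I| <o bounding_number_mod U"
    and A: "\<And>i. i \<in> I \<Longrightarrow> |A i| <o bounding_number_mod U"
  shows "|\<Union>i\<in>I. A i| <o bounding_number_mod U"
proof (rule ccontr)
  have bdd: "\<exists>c\<in>inf_sets. \<forall>a\<in>Z. le_mod U a c"
    if "|Z| <o bounding_number_mod U" "Z \<subseteq> inf_sets" for Z
    using that bounding_number_mod_le[of U Z] not_ordLess_ordLeq unfolding unbounded_mod_def by blast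
  obtain Y where Y: "unbounded_mod U Y" "bounding_number_mod U = |Y|"
    by (rule bounding_number_mod_attained[OF U])
  assume "\<not> ?thesis"
  then have "|Y| \<le>o |\<Union>i\<in>I. A i|" using Y(2) by simp
  moreover have "Y \<noteq> {}" using Y(1) unfolding unbounded_mod_def inf_sets_def by auto
  ultimately obtain p where p: "p ` (\<Union>i\<in>I. A i) = Y"
    using card_of_ordLeq2 by metis
  have "\<exists>c\<in>inf_sets. \<forall>a\<in>p ` A i. le_mod U a c" if "i \<in> I" for i
  proof (rule bdd)
    show "|p ` A i| <o bounding_number_mod U"
      using A[OF that] card_of_image ordLeq_ordLess_trans by blast
    show "p ` A i \<subseteq> inf_sets"
      using p that Y(1) unfolding unbounded_mod_def by blast
  qed
  then obtain c where c: "\<And>i. i \<in> I \<Longrightarrow> c i \<in> inf_sets"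
    "\<And>i a. i \<in> I \<Longrightarrow> a \<in> p ` A i \<Longrightarrow> le_mod U a (c i)" by metis
  have "\<exists>e\<in>inf_sets. \<forall>a\<in>c ` I. le_mod U a e"
  proof (rule bdd)
    show "|c ` I| <o bounding_number_mod U"
      using I card_of_image ordLeq_ordLess_trans by blast
  qed (use c in blast)
  then obtain e where "e \<in> inf_sets" "\<And>i. i \<in> I \<Longrightarrow> le_mod U (c i) e" by blast
  then have "\<forall>a\<in>Y. le_mod U a e"
    using p c(2) le_mod_trans[OF U] by blast
  with \<open>e \<in> inf_sets\<close> Y(1) show False unfolding unbounded_mod_def by blast
qed

subsection \<open>A small family refining an ultrafilter up to closeness\<close>

text \<open>A substitute for saturation by the intervals of \<open>h\<close> in near coherence. It
  tolerates replacing \<open>h\<close> by a faster set, so \<open>b\<close> may range over a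
  dominating family.\<close>

definition nbhd :: "nat set \<Rightarrow> nat set \<Rightarrow> nat set" where
  "nbhd b u = {m. \<exists>k\<in>u. k \<le> enumerate b m \<and> m \<le> enumerate b k}"

definition small_refinement :: "nat set set \<Rightarrow> nat set \<Rightarrow> nat set set \<Rightarrow> bool" where
  "small_refinement U b F \<longleftrightarrow> b \<in> inf_sets \<and> F \<subseteq> inf_sets \<and> |F| <o dominating_number \<and>
     (\<forall>A\<in>U. \<exists>B\<in>F. B \<subseteq> nbhd b A)"

text \<open>Two points \<open>i\<close>, \<open>j\<close> of one interval of \<open>h\<close>
  satisfy \<open>j < enumerate h (Suc i)\<close>, because the index of the interval is at most
  \<open>i\<close>. A \<open>b\<close> dominating this shift of \<open>h\<close> therefore makes
  them close, up to a finite set, which \<open>V\<close> ignores.\<close>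

lemma near_coherent_nbhd:
  assumes V: "ultrafilter V" and nc: "near_coherent U V" and D: "dominating D"
  obtains b where "b \<in> D" "\<And>u. u \<in> U \<Longrightarrow> nbhd b u \<in> V"
proof -
  obtain h where h: "infinite h" and sat: "\<And>u. u \<in> U \<Longrightarrow>
      \<Union>{{enumerate h n..<enumerate h (Suc n)} | n.
            u \<inter> {enumerate h n..<enumerate h (Suc n)} \<noteq> {}} \<in> V"
    using nc unfolding near_coherent_def inf_sets_def by blast
  \<comment> \<open>Dropping the least element shifts the enumeration by one.\<close>
  let ?h = "h - {enumerate h 0}"
  have "?h \<in> inf_sets" using h by (simp add: inf_sets_def)
  then obtain b where b: "b \<in> D" "le_star ?h b"
    using D unfolding dominating_def by blast
  then obtain M where M: "\<And>n. M \<le> n \<Longrightarrow> enumerate h (Suc n) \<le> enumerate b n"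
    unfolding le_star_def MOST_nat_le enumerate_Suc'[symmetric] by blast
  have "nbhd b u \<in> V" if "u \<in> U" for u
  proof -
    let ?S = "\<Union>{{enumerate h n..<enumerate h (Suc n)} | n.
            u \<inter> {enumerate h n..<enumerate h (Suc n)} \<noteq> {}}"
    \<comment> \<open>The first bound lets domination apply at \<open>m\<close>; the second forces
      \<open>M \<le> k\<close> for every \<open>k\<close> in the same interval, so it applies at
      \<open>k\<close> too.\<close>
    let ?E = "{..<max M (enumerate h (Suc M))}"
    have close: "j < enumerate h (Suc i)"
      if "enumerate h n \<le> i" "j < enumerate h (Suc n)" for i j n
    proof -
      have "n \<le> i" using le_enumerate[OF h, of n] that(1) by simp
      then have "enumerate h (Suc n) \<le> enumerate h (Suc i)"
        using h by simp
      with that(2) show ?thesis by simp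
    qed
    have "m \<in> nbhd b u" if "m \<in> ?S" "m \<notin> ?E" for m
    proof -
      from that(1) obtain n k where mk: "enumerate h n \<le> m" "m < enumerate h (Suc n)"
        "k \<in> u" "enumerate h n \<le> k" "k < enumerate h (Suc n)" by auto
      have m: "M \<le> m" "enumerate h (Suc M) \<le> m" using that(2) by auto
      have "m < enumerate h (Suc k)" using close mk by blast
      then have "enumerate h (Suc M) < enumerate h (Suc k)" using m by simp
      then have "M \<le> k" using h by simp
      have "k \<le> enumerate b m" using close[OF mk(1,5)] M[OF m(1)] by simp
      moreover have "m \<le> enumerate b k" using close[OF mk(4,2)] M[OF \<open>M \<le> k\<close>] by simp
      ultimately show ?thesis using mk(3) unfolding nbhd_def by blast
    qed
    then have sub: "?S \<inter> - ?E \<subseteq> nbhd b u" by blast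
    have "?E \<notin> V" using ultrafilter_finite[OF V] by blast
    then have "- ?E \<in> V" using V unfolding ultrafilter_def by blast
    then have "?S \<inter> - ?E \<in> V" using V sat[OF that] unfolding ultrafilter_def by blast
    with sub show ?thesis using V unfolding ultrafilter_def by blast
  qed
  with b(1) that show thesis by blast
qed

lemma card_of_Fpow_less:
  assumes "infinite C" "|A| <o |C|"
  shows "|Fpow A| <o |C|"
proof (cases "finite A")
  case True
  then have "finite (Fpow A)" by (simp add: Fpow_Pow_finite)
  then show ?thesis using assms(1) by simp
next
  case False
  then show ?thesis using card_of_Fpow_infinite assms(2) ordIso_ordLess_trans by blast
qed

text \<open>A finite nonempty \<open>T\<close> has an \<open>r\<close>-greatest element
  \<open>x\<close>, and \<open>step\<close> applies to \<open>x\<close> and \<open>T - {x}\<close>.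
  So a recursion along \<open>r\<close> need only look at earlier stages.\<close>

lemma infinite_INT_by_initial_segments:
  fixes r :: "'a rel" and A :: "'a \<Rightarrow> nat set"
  assumes tot: "total_on D r" and tr: "trans r"
    and step: "\<And>x T. x \<in> D \<Longrightarrow> finite T \<Longrightarrow> T \<subseteq> D \<Longrightarrow> (\<And>y. y \<in> T \<Longrightarrow> (y, x) \<in> r) \<Longrightarrow>
       infinite (A x \<inter> (\<Inter>y\<in>T. A y))"
    and T: "finite T" "T \<subseteq> D"
  shows "infinite (\<Inter>y\<in>T. A y)"
proof (cases "T = {}")
  case True
  then show ?thesis by simp
next
  case False
  have "\<exists>x\<in>T. \<forall>y\<in>T - {x}. (y, x) \<in> r"
    using T(1) False T(2)
  proof (induction T rule: finite_ne_induct)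
    case (singleton x)
    then show ?case by simp
  next
    case (insert z T)
    then obtain x where x: "x \<in> T" "\<forall>y\<in>T - {x}. (y, x) \<in> r" by blast
    have "z \<noteq> x" using insert x by blast
    then consider "(z, x) \<in> r" | "(x, z) \<in> r"
      using tot insert.prems x(1) unfolding total_on_def by blast
    then show ?case
    proof cases
      case 1
      then show ?thesis using x by blast
    next
      case 2
      then have "\<forall>y\<in>T. (y, z) \<in> r" using x tr by (metis DiffI singletonD transD)
      then show ?thesis by blast
    qed
  qed
  then obtain x where x: "x \<in> T" "\<forall>y\<in>T - {x}. (y, x) \<in> r" by blast
  then have "infinite (A x \<inter> (\<Inter>y\<in>T - {x}. A y))"
    using T by (intro step) auto
  moreover have "A x \<inter> (\<Inter>y\<in>T - {x}. A y) = (\<Inter>y\<in>T. A y)" using x(1) by blast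
  ultimately show ?thesis by simp
qed

lemma NCF_small_refinement:
  assumes NCF and U: "ultrafilter U"
  obtains b F where "small_refinement U b F"
proof -
  obtain D where D: "dominating D" and dD: "dominating_number = |D|"
    by (rule dominating_number_attained)
  have Dinf: "infinite D" using dominating_uncountable[OF D] countable_finite by blast
  \<comment> \<open>The strict part of a well-order of \<open>D\<close> of least type, so that
    proper initial segments have size below the dominating number.\<close>
  define r where "r = |D| - Id"
  have wo: "Well_order |D|" and FieldD: "Field |D| = D" by (simp_all add: card_of_Well_order)
  have wf: "wf r" using wo unfolding r_def well_order_on_def by blast
  have tot: "total_on D r"
    using wo FieldD unfolding r_def well_order_on_def linear_order_on_def total_on_def by auto
  have tr: "trans r"
    using wo unfolding r_def well_order_on_def linear_order_on_def partial_order_on_def preorder_on_def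
    by (metis trans_diff_Id)
  have "\<exists>b F. small_refinement U b F"
  proof (rule ccontr)
    assume none: "\<not> ?thesis"
    \<comment> \<open>Requirement on the choice \<open>A\<close> at stage \<open>x\<close>: the new
      complement meets every finite intersection of earlier complements in an infinite set. Nothing
      is asked outside \<open>D\<close>.\<close>
    define P where "P f x A \<longleftrightarrow> (x \<in> D \<longrightarrow> A \<in> U \<and>
      (\<forall>T. finite T \<longrightarrow> T \<subseteq> D \<longrightarrow> (\<forall>y\<in>T. (y, x) \<in> r) \<longrightarrow>
         infinite (- nbhd x A \<inter> (\<Inter>y\<in>T. - nbhd y (f y)))))" for f x A
    have "\<exists>f. \<forall>x. P f x (f x)"
    proof (rule dependent_wf_choice[OF wf])
      fix f g :: "nat set \<Rightarrow> nat set" and x A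
      assume eq: "\<And>z. (z, x) \<in> r \<Longrightarrow> f z = g z"
      have "(\<Inter>y\<in>T. - nbhd y (f y)) = (\<Inter>y\<in>T. - nbhd y (g y))" if "\<forall>y\<in>T. (y, x) \<in> r" for T
        using that eq by auto
      then show "P f x A = P g x A" unfolding P_def by (metis (no_types, lifting))
    next
      fix x f assume IH: "\<And>y. (y, x) \<in> r \<Longrightarrow> P f y (f y)"
      show "\<exists>A. P f x A"
      proof (rule ccontr)
        \<comment> \<open>If the recursion is stuck at \<open>x\<close>, the obstructing
          intersections form a small refinement with \<open>b = x\<close>.\<close>
        assume no: "\<nexists>A. P f x A"
        then have xD: "x \<in> D" unfolding P_def by blast
        let ?S = "underS |D| x"
        have S: "?S = {y \<in> D. (y, x) \<in> r}"
          using FieldD unfolding underS_def r_def by (auto simp: Field_def)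
        have inf: "infinite (\<Inter>y\<in>T. - nbhd y (f y))" if "T \<in> Fpow ?S" for T
        proof (rule infinite_INT_by_initial_segments[of ?S r])
          show "total_on ?S r" using tot S unfolding total_on_def by blast
          show "infinite (- nbhd z (f z) \<inter> (\<Inter>y\<in>T. - nbhd y (f y)))"
            if "z \<in> ?S" "finite T" "T \<subseteq> ?S" "\<And>y. y \<in> T \<Longrightarrow> (y, z) \<in> r" for z T
            using IH[of z] that S unfolding P_def by blast
        qed (use that tr in \<open>auto simp: Fpow_def\<close>)
        \<comment> \<open>Failure of \<open>P\<close> only gives inclusion in
          \<open>nbhd x A\<close> up to a finite set; deleting an initial segment
          \<open>{..<k}\<close> makes it a true inclusion. The factor of all \<open>k\<close> is
          harmless as the dominating number is uncountable.\<close>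
        define F where "F = (\<lambda>(T, k). (\<Inter>y\<in>T. - nbhd y (f y)) - {..<k::nat}) ` (Fpow ?S \<times> UNIV)"
        have "|?S| <o |D|" using xD FieldD by (intro card_of_underS) auto
        then have "|Fpow ?S \<times> (UNIV :: nat set)| <o |D|"
          using Dinf card_of_nat_less_dominating_number dD
          by (intro card_of_Times_ordLess_infinite card_of_Fpow_less) auto
        then have "|F| <o dominating_number"
          unfolding F_def dD using card_of_image ordLeq_ordLess_trans by blast
        moreover have "F \<subseteq> inf_sets"
          using inf unfolding F_def inf_sets_def by auto
        moreover have "\<exists>B\<in>F. B \<subseteq> nbhd x A" if "A \<in> U" for A
        proof -
          have "\<not> P f x A" using no by blast
          then have "\<exists>T. finite T \<and> T \<subseteq> D \<and> (\<forall>y\<in>T. (y, x) \<in> r) \<and>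
              finite (- nbhd x A \<inter> (\<Inter>y\<in>T. - nbhd y (f y)))"
            using xD that unfolding P_def by simp
          then obtain T where T: "finite T" "T \<subseteq> D" "\<forall>y\<in>T. (y, x) \<in> r"
            and fin: "finite (- nbhd x A \<inter> (\<Inter>y\<in>T. - nbhd y (f y)))"
            by blast
          from fin obtain k where k: "- nbhd x A \<inter> (\<Inter>y\<in>T. - nbhd y (f y)) \<subseteq> {..<k}"
            using finite_nat_iff_bounded by blast
          have "T \<in> Fpow ?S" using T S by (auto simp: Fpow_def)
          then have "(\<Inter>y\<in>T. - nbhd y (f y)) - {..<k} \<in> F"
            unfolding F_def by (intro image_eqI[of _ _ "(T, k)"]) auto
          then show ?thesis using k by blast
        qed
        moreover have "x \<in> inf_sets" using D xD unfolding dominating_def by blast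
        ultimately have "small_refinement U x F" unfolding small_refinement_def by blast
        then show False using none by blast
      qed
    qed
    then obtain f where f: "\<And>x. P f x (f x)" by blast
    have "infinite (\<Inter>y\<in>T. - nbhd y (f y))" if "finite T" "T \<subseteq> D" for T
      using tot tr
    proof (rule infinite_INT_by_initial_segments)
      show "infinite (- nbhd z (f z) \<inter> (\<Inter>y\<in>T. - nbhd y (f y)))"
        if "z \<in> D" "finite T" "T \<subseteq> D" "\<And>y. y \<in> T \<Longrightarrow> (y, z) \<in> r" for z T
        using f[of z] that unfolding P_def by blast
    qed (use that in auto)
    then have "infinite (\<Inter>T)" if T: "finite T" "T \<subseteq> (\<lambda>y. - nbhd y (f y)) ` D" for T
      using finite_subset_image[OF T] by auto
    then have "strong_fip ((\<lambda>y. - nbhd y (f y)) ` D)" by (simp add: strong_fip_def)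
    then obtain V where V: "ultrafilter V" "(\<lambda>y. - nbhd y (f y)) ` D \<subseteq> V"
      by (rule ultrafilter_extension)
    \<comment> \<open>Near coherence puts some \<open>nbhd b (f b)\<close> with \<open>b\<close> in
      \<open>D\<close> into \<open>V\<close>, which contains its complement by construction.\<close>
    have "near_coherent U V" using \<open>NCF\<close> U V(1) unfolding NCF_def by blast
    then obtain b where b: "b \<in> D" "\<And>u. u \<in> U \<Longrightarrow> nbhd b u \<in> V"
      using near_coherent_nbhd[OF V(1) _ D] by blast
    have "f b \<in> U" using f[of b] b(1) unfolding P_def by blast
    then have "nbhd b (f b) \<inter> - nbhd b (f b) \<in> V"
      using b V unfolding ultrafilter_def by blast
    then show False using V(1) unfolding ultrafilter_def by simp
  qed
  then show thesis using that by blast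
qed

subsection \<open>Consequences of a small refinement\<close>

text \<open>A range, since bounds must be sets; for infinite \<open>b\<close>, \<open>d\<close>,
  \<open>B\<close> the function is strictly increasing and hence enumerates it.\<close>

definition stretch :: "nat set \<Rightarrow> nat set \<Rightarrow> nat set \<Rightarrow> nat set" where
  "stretch b d B = range (\<lambda>n. enumerate d (enumerate b (enumerate B (Suc (enumerate b n)))))"

lemma
  assumes "b \<in> inf_sets" "d \<in> inf_sets" "B \<in> inf_sets"
  shows stretch_in_inf_sets: "stretch b d B \<in> inf_sets"
    and enumerate_stretch: "enumerate (stretch b d B) n =
      enumerate d (enumerate b (enumerate B (Suc (enumerate b n))))"
proof -
  have "strict_mono (\<lambda>n. enumerate d (enumerate b (enumerate B (Suc (enumerate b n)))))"
    using assms by (simp add: strict_mono_def inf_sets_def)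
  then show "stretch b d B \<in> inf_sets" "enumerate (stretch b d B) n =
      enumerate d (enumerate b (enumerate B (Suc (enumerate b n))))"
    unfolding stretch_def
    by (rule range_strict_mono_in_inf_sets, rule enumerate_range_strict_mono)
qed

text \<open>An inequality on a set in \<open>U\<close> spreads to every \<open>n\<close>: a point
  \<open>m\<close> of \<open>B\<close> beyond \<open>b(n)\<close> is close to some \<open>k\<close>
  with \<open>x(k) \<le> d(k)\<close>. Closeness gives \<open>n \<le> k \<le> b(m)\<close>, so
  \<open>x(n) \<le> x(k) \<le> d(k) \<le> d(b(m))\<close>.\<close>

lemma le_mod_imp_le_stretch:
  assumes ref: "small_refinement U b F"
    and xd: "x \<in> inf_sets" "d \<in> inf_sets" "le_mod U x d"
  obtains B where "B \<in> F" "le_everywhere x (stretch b d B)"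
proof -
  obtain B where B: "B \<in> F" "B \<subseteq> nbhd b {n. enumerate x n \<le> enumerate d n}"
    using ref xd(3) unfolding small_refinement_def le_mod_def by blast
  have inf: "infinite x" "infinite d" "infinite b" "infinite B"
    using ref B(1) xd unfolding small_refinement_def inf_sets_def by auto
  have "enumerate x n \<le> enumerate (stretch b d B) n" for n
  proof -
    \<comment> \<open>As \<open>B(j) \<ge> j\<close>, the \<open>Suc\<close> makes \<open>m\<close>
      strictly larger than \<open>b(n)\<close>.\<close>
    define m where "m = enumerate B (Suc (enumerate b n))"
    have "m \<in> B" unfolding m_def using inf(4) by (rule enumerate_in_set)
    then obtain k where k: "enumerate x k \<le> enumerate d k" "k \<le> enumerate b m" "m \<le> enumerate b k"
      using B(2) unfolding nbhd_def by blast
    have "enumerate b n < m"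
      unfolding m_def using le_enumerate[OF inf(4), of "Suc (enumerate b n)"] by simp
    then have "enumerate b n < enumerate b k" using k(3) by simp
    then have "n \<le> k" using inf by simp
    then have "enumerate x n \<le> enumerate x k" using inf by simp
    also have "\<dots> \<le> enumerate d k" by (rule k(1))
    also have "\<dots> \<le> enumerate d (enumerate b m)" using k(2) inf by simp
    also have "\<dots> = enumerate (stretch b d B) n"
      using inf by (subst enumerate_stretch) (auto simp: m_def inf_sets_def)
    finally show ?thesis .
  qed
  then show thesis using that B(1) unfolding le_everywhere_def by blast
qed

text \<open>If \<open>Y\<close> were smaller than the dominating number, so would be the family of
  stretches of its members by \<open>F\<close>. Some \<open>z\<close> then escapes all of them,
  hence is not \<open>le_mod U\<close>-below any \<open>y\<close> in \<open>Y\<close>, and by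
  linearity bounds \<open>Y\<close>.\<close>

lemma dominating_number_le_bounding_number_mod:
  assumes U: "ultrafilter U" and ref: "small_refinement U b F"
  shows "dominating_number \<le>o bounding_number_mod U"
proof -
  obtain Y where Y: "unbounded_mod U Y" "bounding_number_mod U = |Y|"
    by (rule bounding_number_mod_attained[OF U])
  obtain D where D: "dominating D" "dominating_number = |D|"
    by (rule dominating_number_attained)
  have Dinf: "infinite D" using dominating_uncountable[OF D(1)] countable_finite by blast
  have Ysub: "Y \<subseteq> inf_sets" using Y(1) unfolding unbounded_mod_def by blast
  have bF: "b \<in> inf_sets" "F \<subseteq> inf_sets" "|F| <o |D|"
    using ref D(2) unfolding small_refinement_def by auto
  have "|D| \<le>o |Y|"
  proof (rule ccontr)
    assume "\<not> ?thesis"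
    then have "|Y| <o |D|" by simp
    then have "|Y \<times> F| <o |D|" using Dinf bF(3) by (intro card_of_Times_ordLess_infinite)
    then have "|(\<lambda>(y, B). stretch b y B) ` (Y \<times> F)| <o dominating_number"
      unfolding D(2) using card_of_image ordLeq_ordLess_trans by blast
    then have "\<not> dominating ((\<lambda>(y, B). stretch b y B) ` (Y \<times> F))"
      using dominating_number_le not_ordLess_ordLeq by blast
    moreover have "(\<lambda>(y, B). stretch b y B) ` (Y \<times> F) \<subseteq> inf_sets"
      using Ysub bF by (auto intro!: stretch_in_inf_sets)
    ultimately obtain z where z: "z \<in> inf_sets"
      and zn: "\<And>y B. y \<in> Y \<Longrightarrow> B \<in> F \<Longrightarrow> \<not> le_star z (stretch b y B)"
      unfolding dominating_def by auto
    have "le_mod U y z" if "y \<in> Y" for y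
    proof (rule le_mod_linear[OF U], rule notI)
      assume zy: "le_mod U z y"
      have "y \<in> inf_sets" using that Ysub by blast
      from le_mod_imp_le_stretch[OF ref z this zy]
      obtain B where "B \<in> F" "le_everywhere z (stretch b y B)" .
      moreover from this have "le_star z (stretch b y B)"
        unfolding le_everywhere_def le_star_def by simp
      ultimately show False using zn[OF that] by blast
    qed
    with z Y(1) show False unfolding unbounded_mod_def by blast
  qed
  then show ?thesis using Y(2) D(2) by simp
qed

text \<open>A dominating family is unbounded modulo \<open>U\<close>, because \<open>le_star\<close>
  implies \<open>le_mod U\<close>.\<close>

lemma bounding_number_mod_le_dominating_number:
  assumes U: "ultrafilter U"
  shows "bounding_number_mod U \<le>o dominating_number"
proof -
  obtain D where D: "dominating D" "dominating_number = |D|"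
    by (rule dominating_number_attained)
  have "\<exists>a\<in>D. \<not> le_mod U a c" if c: "c \<in> inf_sets" for c
  proof -
    obtain a where a: "a \<in> inf_sets" "\<not> le_mod U a c"
      using unbounded_mod_inf_sets[OF U] c unfolding unbounded_mod_def by blast
    obtain b where b: "b \<in> D" "le_star a b" using D(1) a(1) unfolding dominating_def by blast
    have "finite {n. \<not> enumerate a n \<le> enumerate b n}"
      using b(2) unfolding le_star_def MOST_iff_cofinite by simp
    then have "{n. \<not> enumerate a n \<le> enumerate b n} \<notin> U" by (rule ultrafilter_finite[OF U])
    then have "- {n. \<not> enumerate a n \<le> enumerate b n} \<in> U"
      using U unfolding ultrafilter_def by blast
    moreover have "- {n. \<not> enumerate a n \<le> enumerate b n} = {n. enumerate a n \<le> enumerate b n}"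
      by auto
    ultimately have "le_mod U a b" by (simp add: le_mod_def)
    then show ?thesis using a(2) b(1) le_mod_trans[OF U] by blast
  qed
  then have "unbounded_mod U D" using D(1) unfolding unbounded_mod_def dominating_def by blast
  then show ?thesis unfolding D(2) by (rule bounding_number_mod_le)
qed

theorem theorem6p1:
  fixes U :: "nat set set"
  assumes "NCF"
    and "U \<subseteq> inf_sets"
    and "ultrafilter U"
  shows "\<forall>X. X \<subseteq> inf_sets \<longrightarrow> d_unbounded X \<longrightarrow> scale_mod U X"
proof (intro allI impI)
  fix X assume X: "X \<subseteq> inf_sets" and unb: "d_unbounded X"
  note U = \<open>ultrafilter U\<close>
  obtain b F where ref: "small_refinement U b F"
    using NCF_small_refinement[OF \<open>NCF\<close> U] by blast
  note db = dominating_number_le_bounding_number_mod[OF U ref]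
  have bX: "bounding_number_mod U \<le>o |X|"
    using unb bounding_number_mod_le_dominating_number[OF U] ordLeq_transitive
    unfolding d_unbounded_def by blast
  have "\<exists>c\<in>inf_sets. \<exists>S. S \<subseteq> X \<and> |S| <o bounding_number_mod U \<and>
        le_mod (positive_sets U) d c \<and> (\<forall>x\<in>X - S. le_mod U c x)" if d: "d \<in> inf_sets" for d
  proof (intro bexI[OF _ d] exI conjI)
    \<comment> \<open>The witness \<open>c\<close> is \<open>d\<close> itself: by linearity every
      \<open>x\<close> outside \<open>?S\<close> lies above it modulo \<open>U\<close>.\<close>
    let ?S = "{x \<in> X. le_mod U x d}"
    show "?S \<subseteq> X" by blast
    show "\<forall>x\<in>X - ?S. le_mod U d x" using le_mod_linear[OF U] by blast
    show "le_mod (positive_sets U) d d"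
      using U by (simp add: le_mod_def positive_sets_def ultrafilter_def)
    \<comment> \<open>Each member of \<open>?S\<close> lies everywhere below one of the few
      stretches of \<open>d\<close>. By \<open>d_unbounded X\<close> each stretch has few members of
      \<open>X\<close> below it, and regularity handles the union.\<close>
    have "|\<Union>B\<in>F. {x \<in> X. le_everywhere x (stretch b d B)}| <o bounding_number_mod U"
    proof (rule card_of_UN_less_bounding_number_mod[OF U])
      show "|F| <o bounding_number_mod U"
        using ref db ordLess_ordLeq_trans unfolding small_refinement_def by blast
      fix B assume "B \<in> F"
      then have "stretch b d B \<in> inf_sets"
        using ref d stretch_in_inf_sets unfolding small_refinement_def by blast
      then show "|{x \<in> X. le_everywhere x (stretch b d B)}| <o bounding_number_mod U"
        using unb db ordLess_ordLeq_trans unfolding d_unbounded_def by blast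
    qed
    moreover have "?S \<subseteq> (\<Union>B\<in>F. {x \<in> X. le_everywhere x (stretch b d B)})"
      using le_mod_imp_le_stretch[OF ref] X d by blast
    ultimately show "|?S| <o bounding_number_mod U"
      using card_of_mono1 ordLeq_ordLess_trans by blast
  qed
  with X bX show "scale_mod U X" unfolding scale_mod_def by blast
qed

end
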